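(* Let $d \ge 1$ and $N \ge N' \ge 1$ be integers. Suppose we have $N$ pairs of points in $\mathbb{R}^d$, each pair considered as a color class, such that the maximum number of pairs that a single hyperplane splits simultaneously is $N'$. Then there exists a colorful partition of the union of the pairs into two parts that remains a Tverberg partition even after the removal of any $t$ pairs, for some $t = N - \frac{N'}{2} - O(\sqrt{N' \ln N})$. Moreover, for every colorful partition of the union of the pairs into two parts, there is a set of at most $N - \frac{N'}{2}$ pairs whose removal makes it fail to be a Tverberg partition.
   Context: A hyperplane splits a pair of points if the two points lie in different open half-spaces determined by the hyperplane. A colorful partition of the union of the $N$ pairs is a partition into two parts $A_1,A_2$ such that each part contains exactly one point of each pair. A partition is a Tverberg partition if the convex hulls of its parts intersect. Removing a pair means deleting both of its points from the parts; a partition remains a Tverberg partition after removal of pairs if the convex hulls of the remaining parts still intersect. *)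

theory Defs
  imports "HOL-Analysis.Analysis"
begin

text \<open>A family of \<open>N\<close> pairs of points is a map \<open>x :: nat \<times> bool \<Rightarrow> real ^ 'n\<close>, the pair of colour
  \<open>i < N\<close> being \<open>x (i, False)\<close>, \<open>x (i, True)\<close>. Partitions are partitions of the labels
  \<open>{..<N} \<times> UNIV\<close>, so that points may coincide in space and are then counted with multiplicity.\<close>

definition splits :: "real ^ 'n \<Rightarrow> real \<Rightarrow> real ^ 'n \<Rightarrow> real ^ 'n \<Rightarrow> bool" where
  "splits a b y z \<longleftrightarrow> (inner a y < b \<and> b < inner a z) \<or> (inner a z < b \<and> b < inner a y)"

text \<open>The hyperplane \<open>{y. inner a y = b}\<close>, with \<open>a \<noteq> 0\<close>, determines the open half-spaces
  \<open>{y. inner a y < b}\<close> and \<open>{y. inner a y > b}\<close>. The set below is a nonempty subset of \<open>{..N}\<close>,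
  so \<open>Max\<close> is a genuine maximum.\<close>

definition max_split :: "nat \<Rightarrow> (nat \<times> bool \<Rightarrow> real ^ 'n) \<Rightarrow> nat" where
  "max_split N x =
     Max {card {i. i < N \<and> splits a b (x (i, False)) (x (i, True))} | a b. a \<noteq> 0}"

definition colorful_partition :: "nat \<Rightarrow> (nat \<times> bool) set \<Rightarrow> (nat \<times> bool) set \<Rightarrow> bool" where
  "colorful_partition N A1 A2 \<longleftrightarrow>
     A1 \<union> A2 = {..<N} \<times> UNIV \<and> A1 \<inter> A2 = {} \<and>
     (\<forall>i<N. (\<exists>!c. (i, c) \<in> A1) \<and> (\<exists>!c. (i, c) \<in> A2))"

definition tverberg_partition ::
  "(nat \<times> bool \<Rightarrow> real ^ 'n) \<Rightarrow> (nat \<times> bool) set \<Rightarrow> (nat \<times> bool) set \<Rightarrow> bool" where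
  "tverberg_partition x A1 A2 \<longleftrightarrow> convex hull (x ` A1) \<inter> convex hull (x ` A2) \<noteq> {}"

definition remove_pairs :: "nat set \<Rightarrow> (nat \<times> bool) set \<Rightarrow> (nat \<times> bool) set" where
  "remove_pairs S A = A - S \<times> UNIV"

text \<open>The number \<open>t\<close> is an integer because \<open>N - N' / 2 - O(sqrt (N' * ln N))\<close> can be negative
  when \<open>N\<close> is small compared with the dimension; there is then nothing to remove and the
  condition is void.\<close>

definition tolerant ::
  "nat \<Rightarrow> int \<Rightarrow> (nat \<times> bool \<Rightarrow> real ^ 'n) \<Rightarrow> (nat \<times> bool) set \<Rightarrow> (nat \<times> bool) set \<Rightarrow> bool" where
  "tolerant N t x A1 A2 \<longleftrightarrow>
     (\<forall>S \<subseteq> {..<N}. int (card S) = t \<longrightarrow>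
        tverberg_partition x (remove_pairs S A1) (remove_pairs S A2))"

end

theory Submission
  imports Defs
begin

text \<open>Colour the pairs at random. If deleting the pairs in \<open>S\<close> destroys the intersection of the two
  hulls, a hyperplane strictly separates the remaining points, so all \<open>N - |S|\<close> remaining pairs are
  split by it, each with its point of the first part on the prescribed side. A fixed hyperplane splits
  at most \<open>N'\<close> pairs, and by Chernoff's bound the probability that at least \<open>N' / 2 + e\<close> of them are
  oriented alike is at most \<open>exp (- 2 * e\<^sup>2 / N')\<close>. Radon's theorem and the Sauer-Shelah lemma leave
  polynomially many hyperplanes to consider, so a union bound with \<open>e\<close> of order
  \<open>sqrt (N' * ln N)\<close> produces a good colouring. Conversely, for a hyperplane that splits
  \<open>N'\<close> pairs, at least half of the split pairs are oriented alike, and deleting all others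
  separates the hulls.\<close>

section \<open>Shattered sets and the Sauer-Shelah bound\<close>

definition shatters :: "'a set set \<Rightarrow> 'a set \<Rightarrow> bool" where
  "shatters F Y \<longleftrightarrow> (\<forall>Z\<subseteq>Y. \<exists>A\<in>F. A \<inter> Y = Z)"

text \<open>Pajor's form of the Sauer-Shelah lemma, which needs no bound on the dimension and is
  therefore amenable to induction on the ground set.\<close>

lemma card_le_card_shattered:
  assumes "finite X" "F \<subseteq> Pow X"
  shows "card F \<le> card {Y. Y \<subseteq> X \<and> shatters F Y}"
  using assms
proof (induction X arbitrary: F rule: finite_induct)
  case empty
  then consider "F = {}" | "F = {{}}" by auto
  then show ?case
  proof cases
    case 2
    then have "{Y. Y \<subseteq> {} \<and> shatters F Y} = {{}}" by (auto simp: shatters_def)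
    with 2 show ?thesis by (metis order_refl card_1_singleton_iff One_nat_def)
  qed simp
next
  case (insert a X)
  define F0 where "F0 = {A \<in> F. a \<notin> A}"
  define F1 where "F1 = (\<lambda>A. A - {a}) ` {A \<in> F. a \<in> A}"
  define S where "S = (\<lambda>F. {Y. Y \<subseteq> X \<and> shatters F Y})"
  have fin: "finite (S G)" for G
    unfolding S_def using insert.hyps by simp
  have finF: "finite F"
    using insert by (meson finite_Pow_iff finite_insert finite_subset)
  have "card F = card F0 + card {A \<in> F. a \<in> A}"
    unfolding F0_def using finF by (subst card_Un_disjoint[symmetric]) (auto intro!: arg_cong[where f=card])
  also have "card {A \<in> F. a \<in> A} = card F1"
    unfolding F1_def by (intro card_image[symmetric] inj_onI) blast
  also have "card F0 \<le> card (S F0)"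
    unfolding S_def by (rule insert.IH) (use insert.prems in \<open>auto simp: F0_def\<close>)
  also have "card F1 \<le> card (S F1)"
    unfolding S_def by (rule insert.IH) (use insert.prems in \<open>auto simp: F1_def\<close>)
  \<comment> \<open>A set shattered by both \<open>F0\<close> and \<open>F1\<close> is counted twice
    here. Its second copy is represented by the set with \<open>a\<close> added, which
    \<open>F\<close> shatters as well: \<open>F0\<close> realises the traces without
    \<open>a\<close>, \<open>F1\<close> those with \<open>a\<close>.\<close>
  also have "card (S F0) + card (S F1) = card (S F0 \<union> S F1) + card (S F0 \<inter> S F1)"
    using fin by (intro card_Un_Int) auto
  also have "card (S F0 \<inter> S F1) = card (Set.insert a ` (S F0 \<inter> S F1))"
    using insert.hyps(2) by (intro card_image[symmetric] inj_onI) (auto simp: S_def)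
  also have "card (S F0 \<union> S F1) + \<dots> = card ((S F0 \<union> S F1) \<union> Set.insert a ` (S F0 \<inter> S F1))"
    using insert.hyps(2) fin by (intro card_Un_disjoint[symmetric]) (auto simp: S_def)
  also have "\<dots> \<le> card {Y. Y \<subseteq> insert a X \<and> shatters F Y}"
  proof (rule card_mono)
    show "finite {Y. Y \<subseteq> insert a X \<and> shatters F Y}"
      using insert.hyps by simp
    have 0: "shatters F Y" if "shatters F0 Y" for Y
      using that unfolding shatters_def F0_def by blast
    have 1: "shatters F Y" if Y: "Y \<subseteq> X" "shatters F1 Y" for Y
      unfolding shatters_def
    proof (intro allI impI)
      fix Z assume "Z \<subseteq> Y"
      then obtain A where A: "A \<in> F" "(A - {a}) \<inter> Y = Z"
        using Y(2) unfolding shatters_def F1_def by blast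
      moreover have "a \<notin> Y" using Y insert.hyps by blast
      ultimately show "\<exists>A\<in>F. A \<inter> Y = Z" by blast
    qed
    have 2: "shatters F (insert a Y)" if Y: "Y \<subseteq> X" "shatters F0 Y" "shatters F1 Y" for Y
      unfolding shatters_def
    proof (intro allI impI)
      have aY: "a \<notin> Y" using Y insert.hyps by blast
      fix Z assume Z: "Z \<subseteq> insert a Y"
      then have sub: "Z - {a} \<subseteq> Y" by blast
      show "\<exists>A\<in>F. A \<inter> insert a Y = Z"
      proof (cases "a \<in> Z")
        case True
        obtain B where "B \<in> F1" "B \<inter> Y = Z - {a}"
          using Y(3) sub unfolding shatters_def by meson
        then obtain A where "A \<in> F" "a \<in> A" "(A - {a}) \<inter> Y = Z - {a}"
          unfolding F1_def by blast
        with True aY have "A \<inter> insert a Y = Z" by blast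
        with \<open>A \<in> F\<close> show ?thesis by blast
      next
        case False
        obtain A where "A \<in> F0" "A \<inter> Y = Z - {a}"
          using Y(2) sub unfolding shatters_def by meson
        with False aY have "A \<in> F" "A \<inter> insert a Y = Z"
          unfolding F0_def by blast+
        then show ?thesis by blast
      qed
    qed
    show "(S F0 \<union> S F1) \<union> Set.insert a ` (S F0 \<inter> S F1) \<subseteq> {Y. Y \<subseteq> insert a X \<and> shatters F Y}"
      using 0 1 2 by (auto simp: S_def)
  qed
  finally show ?case by simp
qed

text \<open>A shattered set has one of the sizes 0 to \<open>k\<close>, and each binomial
  coefficient is at most \<open>card X ^ k\<close>. This crude form suffices, as only polynomial
  growth enters the union bound.\<close>

lemma sauer_shelah:
  assumes "finite X" "X \<noteq> {}" "F \<subseteq> Pow X"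
    and "\<And>Y. Y \<subseteq> X \<Longrightarrow> shatters F Y \<Longrightarrow> card Y \<le> k"
  shows "card F \<le> (k + 1) * card X ^ k"
proof -
  have "card F \<le> card {Y. Y \<subseteq> X \<and> shatters F Y}"
    using assms by (intro card_le_card_shattered)
  also have "\<dots> \<le> card (\<Union>i\<in>{..k}. {Y. Y \<subseteq> X \<and> card Y = i})"
    using assms by (intro card_mono) auto
  also have "\<dots> \<le> (\<Sum>i\<in>{..k}. card {Y. Y \<subseteq> X \<and> card Y = i})"
    by (rule card_UN_le) simp
  also have "\<dots> \<le> (\<Sum>i\<in>{..k}. card X ^ k)"
  proof (rule sum_mono)
    fix i assume i: "i \<in> {..k}"
    have "card X choose i \<le> card X ^ i"
      by (cases "i \<le> card X") (auto intro: binomial_le_pow simp: binomial_eq_0)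
    also have "\<dots> \<le> card X ^ k"
      using i assms by (intro power_increasing) (auto simp: Suc_leI card_gt_0_iff)
    finally show "card {Y. Y \<subseteq> X \<and> card Y = i} \<le> card X ^ k"
      using assms by (simp add: n_subsets)
  qed
  finally show ?thesis by simp
qed

section \<open>Counting the traces of half-spaces\<close>

text \<open>Traces consist of labels, so coinciding points stay distinct. The case
  \<open>a = 0\<close> contributes only the empty set and \<open>X\<close>; the opposite open side
  of a hyperplane arises from \<open>- a\<close> and \<open>- b\<close>.\<close>

definition halfspace_traces :: "('l \<Rightarrow> 'a::real_inner) \<Rightarrow> 'l set \<Rightarrow> 'l set set" where
  "halfspace_traces x X = {{p \<in> X. inner a (x p) < b} | a b. True}"

text \<open>With at least d + 2 points, Radon's theorem yields two disjoint subsets whose hulls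
  meet, so no half-space cuts off one from the other.\<close>

lemma card_shattered_by_halfspaces_le:
  fixes x :: "'l \<Rightarrow> 'a::euclidean_space"
  assumes "finite X" "Y \<subseteq> X" "shatters (halfspace_traces x X) Y"
  shows "card Y \<le> DIM('a) + 1"
proof (rule ccontr)
  assume big: "\<not> card Y \<le> DIM('a) + 1"
  have cut: "\<exists>a b. \<forall>p\<in>Y. p \<in> Z \<longleftrightarrow> inner a (x p) < b" if Z: "Z \<subseteq> Y" for Z
  proof -
    obtain A where A: "A \<in> halfspace_traces x X" "A \<inter> Y = Z"
      using assms(3) Z unfolding shatters_def by blast
    then obtain a b where "A = {p \<in> X. inner a (x p) < b}"
      unfolding halfspace_traces_def by blast
    with A assms(2) show ?thesis by blast
  qed
  \<comment> \<open>Radon's theorem counts points, not labels. No half-space separates two labels of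
    one point, so shattering forces distinct points.\<close>
  have inj: "inj_on x Y"
  proof (rule inj_onI)
    fix p q assume "p \<in> Y" "q \<in> Y" "x p = x q"
    then show "p = q" using cut[of "{p}"] by (metis empty_subsetI insert_subset singleton_iff)
  qed
  have "finite Y" using assms finite_subset by blast
  then have "affine_dependent (x ` Y)"
    using big inj by (intro affine_dependent_biggerset) (auto simp: card_image)
  then obtain M P where MP: "M \<subseteq> x ` Y" "P \<subseteq> x ` Y" "M \<inter> P = {}"
    "convex hull M \<inter> convex hull P \<noteq> {}"
    by (rule Radon)
  obtain a b where ab: "\<And>p. p \<in> Y \<Longrightarrow> p \<in> {p \<in> Y. x p \<in> M} \<longleftrightarrow> inner a (x p) < b"
    using cut[of "{p \<in> Y. x p \<in> M}"] by blast
  have "convex hull M \<subseteq> {y. inner a y < b}"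
    using MP ab by (intro hull_minimal convex_halfspace_lt) blast
  moreover have "convex hull P \<subseteq> {y. inner a y \<ge> b}"
  proof (intro hull_minimal convex_halfspace_ge subsetI CollectI)
    fix y assume y: "y \<in> P"
    then obtain p where p: "p \<in> Y" "y = x p" using MP by blast
    then have "y \<notin> M" using MP y by blast
    then show "inner a y \<ge> b" using ab[OF p(1)] p by auto
  qed
  ultimately have "convex hull M \<inter> convex hull P = {}" by fastforce
  with MP show False by blast
qed

lemma card_halfspace_traces_le:
  fixes x :: "'l \<Rightarrow> 'a::euclidean_space"
  assumes "finite X" "X \<noteq> {}" "DIM('a) + 1 = k"
  shows "card (halfspace_traces x X) \<le> (k + 1) * card X ^ k"
  by (intro sauer_shelah card_shattered_by_halfspaces_le[of X _ x, unfolded assms(3)] assms)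
     (auto simp: halfspace_traces_def)

section \<open>Chernoff's bound in counting form\<close>

text \<open>The Taylor series compare term by term because
  \<open>2 ^ m * fact m \<le> fact (2 * m)\<close>. The left side is the exponential moment of a
  fair sign.\<close>

lemma cosh_le_exp_half_square: "cosh x \<le> exp (x\<^sup>2 / 2)" for x :: real
proof -
  \<comment> \<open>The exponential series of \<open>x\<^sup>2 / 2\<close>, spread over the even
    indices to match the series of \<open>cosh\<close>.\<close>
  define f where "f n = (if even n then (x\<^sup>2 / 2) ^ (n div 2) /\<^sub>R fact (n div 2) else 0)" for n
  have "(\<lambda>m. f (2 * m)) sums exp (x\<^sup>2 / 2)"
    unfolding f_def using exp_converges[of "x\<^sup>2 / 2"] by simp
  then have 1: "f sums exp (x\<^sup>2 / 2)"
    by (subst (asm) sums_mono_reindex) (auto simp: strict_mono_def f_def elim!: evenE)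
  have dbl: "2 ^ m * fact m \<le> (fact (2 * m) :: real)" for m
  proof (induction m)
    case (Suc m)
    have "2 ^ Suc m * fact (Suc m) = (2 * real (Suc m)) * (2 ^ m * fact m)" by simp
    also have "\<dots> \<le> (2 * real (Suc m)) * fact (2 * m)"
      using Suc by (intro mult_left_mono) auto
    also have "\<dots> \<le> (2 * real (Suc m)) * ((2 * real m + 1) * fact (2 * m))"
      by (intro mult_left_mono) (auto simp: mult_le_cancel_right1)
    also have "\<dots> = fact (2 * Suc m)" by (simp add: algebra_simps)
    finally show ?case .
  qed simp
  have "(if even n then x ^ n /\<^sub>R fact n else 0) \<le> f n" for n
  proof (cases "even n")
    case True
    then obtain m where n: "n = 2 * m" by (elim evenE)
    have "x ^ (2 * m) / fact (2 * m) \<le> x ^ (2 * m) / (2 ^ m * fact m)"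
      using dbl by (intro divide_left_mono) (auto simp: power_mult)
    also have "\<dots> = (x\<^sup>2 / 2) ^ m / fact m"
      by (simp add: power_divide power_mult)
    finally have "x ^ (2 * m) / fact (2 * m) \<le> (x\<^sup>2 / 2) ^ m / fact m" .
    moreover have "x ^ n /\<^sub>R fact n = x ^ (2 * m) / fact (2 * m)"
      "f n = (x\<^sup>2 / 2) ^ m / fact m"
      by (simp_all only: f_def n real_scaleR_def divide_inverse_commute) simp
    ultimately show ?thesis using True by (metis (full_types))
  qed (simp add: f_def)
  then show ?thesis using sums_le[OF _ cosh_converges 1] by blast
qed

text \<open>Probability is replaced by counting the colourings \<open>E\<close> of \<open>I\<close>.
  For a hyperplane, \<open>M\<close> will hold the split pairs and \<open>T\<close> their
  orientations, so agreement means being oriented alike; \<open>n\<close> is a bound common to all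
  hyperplanes.\<close>

lemma card_agreement_ge_le:
  fixes e :: real
  assumes "finite I" "M \<subseteq> I" "card M \<le> n" "0 < n" "0 \<le> e"
  shows "real (card {E \<in> Pow I. real (card {i \<in> M. i \<in> E \<longleftrightarrow> i \<in> T}) \<ge> real n / 2 + e})
           \<le> 2 ^ card I * exp (- 2 * e\<^sup>2 / n)"
proof -
  \<comment> \<open>The minimiser of \<open>n * l\<^sup>2 / 2 - 2 * e * l\<close>, the final exponent of the exponential moment bound.\<close>
  define l where "l = 2 * e / n"
  have l: "l \<ge> 0" using assms by (simp add: l_def)
  \<comment> \<open>The weight \<open>w E\<close> is the exponential of \<open>l\<close> times
    agreements minus disagreements on \<open>M\<close>. Its product form lets
    \<open>prod_add\<close> factor the sum over \<open>Pow I\<close>.\<close>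
  define s where "s Q i = (if i \<in> M then if Q \<longleftrightarrow> i \<in> T then exp l else exp (- l) else 1)" for Q i
  define w where "w E = (\<Prod>i\<in>E. s True i) * (\<Prod>i\<in>I-E. s False i)" for E
  define B where "B = {E \<in> Pow I. real (card {i \<in> M. i \<in> E \<longleftrightarrow> i \<in> T}) \<ge> real n / 2 + e}"
  have finM: "finite M" using assms finite_subset by blast
  have s_pos: "s Q i > 0" for Q i by (simp add: s_def)
  have w_pos: "w E \<ge> 0" for E
    unfolding w_def by (intro mult_nonneg_nonneg prod_nonneg less_imp_le s_pos)
  have w_eq: "w E = exp (l * (2 * real (card {i \<in> M. i \<in> E \<longleftrightarrow> i \<in> T}) - real (card M)))" if "E \<subseteq> I" for E
  proof -
    have "w E = (\<Prod>i\<in>E. s (i \<in> E) i) * (\<Prod>i\<in>I-E. s (i \<in> E) i)"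
      unfolding w_def by (intro arg_cong2[where f="(*)"] prod.cong) auto
    also have "\<dots> = (\<Prod>i\<in>I. s (i \<in> E) i)"
      by (simp add: prod.subset_diff[OF that assms(1)] mult.commute)
    also have "\<dots> = (\<Prod>i\<in>M. s (i \<in> E) i)"
      using assms by (intro prod.mono_neutral_right) (auto simp: s_def)
    also have "\<dots> = (\<Prod>i\<in>M. exp (l * (2 * of_bool (i \<in> E \<longleftrightarrow> i \<in> T) - 1)))"
      by (intro prod.cong) (auto simp: s_def)
    also have "\<dots> = exp (\<Sum>i\<in>M. l * (2 * of_bool (i \<in> E \<longleftrightarrow> i \<in> T) - 1))"
      by (simp add: exp_sum finM)
    also have "(\<Sum>i\<in>M. l * (2 * of_bool (i \<in> E \<longleftrightarrow> i \<in> T) - 1)) =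
        l * (2 * (\<Sum>i\<in>M. of_bool (i \<in> E \<longleftrightarrow> i \<in> T)) - real (card M))"
      by (simp add: sum_distrib_left[symmetric] sum_subtractf)
    also have "(\<Sum>i\<in>M. of_bool (i \<in> E \<longleftrightarrow> i \<in> T)) = real (card {i \<in> M. i \<in> E \<longleftrightarrow> i \<in> T})"
      using finM by (simp add: Int_def)
    finally show ?thesis .
  qed
  \<comment> \<open>Markov's inequality: as \<open>card M \<le> n\<close>, agreements exceed
    disagreements by at least \<open>2 * e\<close> for every \<open>E\<close> in
    \<open>B\<close>.\<close>
  have "real (card B) * exp (2 * e * l) = (\<Sum>E\<in>B. exp (2 * e * l))" by simp
  also have "\<dots> \<le> (\<Sum>E\<in>B. w E)"
  proof (rule sum_mono)
    fix E assume E: "E \<in> B"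
    have "real (card M) \<le> real n" using assms by simp
    with E have "2 * e \<le> 2 * real (card {i \<in> M. i \<in> E \<longleftrightarrow> i \<in> T}) - real (card M)"
      by (simp add: B_def)
    from mult_left_mono[OF this l] E show "exp (2 * e * l) \<le> w E"
      by (subst w_eq) (auto simp: B_def mult_ac)
  qed
  also have "\<dots> \<le> (\<Sum>E\<in>Pow I. w E)"
    using assms w_pos by (intro sum_mono2) (auto simp: B_def)
  also have "\<dots> = (\<Prod>i\<in>I. s True i + s False i)"
    using assms by (simp add: prod_add w_def)
  \<comment> \<open>An index in \<open>M\<close> contributes
    \<open>exp l + exp (- l) = 2 * cosh l\<close>, any other index 2.\<close>
  also have "\<dots> \<le> (\<Prod>i\<in>I. 2 * (if i \<in> M then exp (l\<^sup>2 / 2) else 1))"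
  proof (rule prod_mono, intro conjI)
    fix i
    show "s True i + s False i \<le> 2 * (if i \<in> M then exp (l\<^sup>2 / 2) else 1)"
      using cosh_le_exp_half_square[of l] by (auto simp: s_def cosh_field_def)
  qed (auto intro: add_nonneg_nonneg less_imp_le s_pos)
  also have "\<dots> = 2 ^ card I * exp (l\<^sup>2 / 2) ^ card M"
    using assms by (simp add: prod.distrib prod.If_cases Int_absorb1)
  also have "\<dots> \<le> 2 ^ card I * exp (l\<^sup>2 / 2) ^ n"
    using assms by (intro mult_left_mono power_increasing) auto
  also have "\<dots> = 2 ^ card I * exp (n * l\<^sup>2 / 2)"
    by (simp add: exp_of_nat_mult[symmetric])
  finally have "real (card B) * exp (2 * e * l) \<le> 2 ^ card I * exp (n * l\<^sup>2 / 2)" .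
  then have "real (card B) \<le> 2 ^ card I * exp (n * l\<^sup>2 / 2) / exp (2 * e * l)"
    by (simp add: pos_le_divide_eq)
  also have "\<dots> = 2 ^ card I * exp (n * l\<^sup>2 / 2 - 2 * e * l)"
    by (simp add: exp_diff)
  also have "n * l\<^sup>2 / 2 - 2 * e * l = - 2 * e\<^sup>2 / n"
    using assms by (simp add: l_def field_simps power2_eq_square)
  finally show ?thesis by (simp add: B_def)
qed

section \<open>Split counts and separating hyperplanes\<close>

lemma
  fixes x :: "nat \<times> bool \<Rightarrow> real ^ 'n"
  shows card_split_le_max_split:
    "a \<noteq> 0 \<Longrightarrow> card {i. i < N \<and> splits a b (x (i, False)) (x (i, True))} \<le> max_split N x"
    and max_split_attained:
    "\<exists>a b. a \<noteq> 0 \<and> card {i. i < N \<and> splits a b (x (i, False)) (x (i, True))} = max_split N x"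
proof -
  define V where
    "V = {card {i. i < N \<and> splits a b (x (i, False)) (x (i, True))} | a b. a \<noteq> 0}"
  have "card {i. i < N \<and> P i} \<le> N" for P
    using card_mono[of "{..<N}" "{i. i < N \<and> P i}"] by auto
  then have fin: "finite V"
    by (intro finite_subset[of V "{..N}"]) (auto simp: V_def)
  then show "a \<noteq> 0 \<Longrightarrow> card {i. i < N \<and> splits a b (x (i, False)) (x (i, True))} \<le> max_split N x"
    unfolding max_split_def V_def[symmetric] by (intro Max_ge) (auto simp: V_def)
  obtain a :: "real ^ 'n" where "a \<noteq> 0"
    by (metis vector_one_nth zero_index zero_neq_one)
  then have "V \<noteq> {}" by (auto simp: V_def)
  with fin have "Max V \<in> V" by (rule Max_in)
  then show "\<exists>a b. a \<noteq> 0 \<and> card {i. i < N \<and> splits a b (x (i, False)) (x (i, True))} = max_split N x"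
    unfolding max_split_def V_def[symmetric] unfolding V_def by fastforce
qed

lemma not_tverberg_partition_if_separated:
  fixes x :: "nat \<times> bool \<Rightarrow> real ^ 'n"
  assumes "\<And>p. p \<in> A1 \<Longrightarrow> inner a (x p) < b" "\<And>p. p \<in> A2 \<Longrightarrow> b < inner a (x p)"
  shows "\<not> tverberg_partition x A1 A2"
proof -
  have "convex hull (x ` A1) \<subseteq> {y. inner a y < b}" "convex hull (x ` A2) \<subseteq> {y. inner a y > b}"
    using assms by (intro hull_minimal convex_halfspace_lt convex_halfspace_gt; blast)+
  then show ?thesis unfolding tverberg_partition_def by fastforce
qed

lemma separated_if_not_tverberg_partition:
  fixes x :: "nat \<times> bool \<Rightarrow> real ^ 'n"
  assumes "finite A1" "finite A2" "\<not> tverberg_partition x A1 A2"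
  obtains a b where "\<And>p. p \<in> A1 \<Longrightarrow> inner a (x p) < b" "\<And>p. p \<in> A2 \<Longrightarrow> b < inner a (x p)"
\<comment> \<open>The separation theorem wants a nonempty compact set. For empty \<open>A2\<close>
  the zero normal serves, so \<open>a\<close> may vanish in the conclusion.\<close>
proof (cases "A2 = {}")
  case True
  then show ?thesis using that[of 0 1] by simp
next
  case False
  have "\<exists>a b. (\<forall>y\<in>convex hull (x ` A1). inner a y < b) \<and> (\<forall>y\<in>convex hull (x ` A2). b < inner a y)"
    using assms False unfolding tverberg_partition_def
    by (intro separating_hyperplane_closed_compact compact_imp_closed compact_convex_hull)
       (auto intro: finite_imp_compact)
  then show ?thesis using that by (meson hull_inc image_eqI)
qed

section \<open>Breaking an arbitrary colorful partition\<close>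

lemma breaking_pairs:
  fixes x :: "nat \<times> bool \<Rightarrow> real ^ 'n"
  assumes "colorful_partition N A1 A2"
  shows "\<exists>S \<subseteq> {..<N}. real (card S) \<le> real N - real (max_split N x) / 2 \<and>
           \<not> tverberg_partition x (remove_pairs S A1) (remove_pairs S A2)"
proof -
  obtain a b where ab: "card {i. i < N \<and> splits a b (x (i, False)) (x (i, True))} = max_split N x"
    using max_split_attained by blast
  \<comment> \<open>The pairs with their \<open>B\<close> points strictly below and their
    \<open>C\<close> points strictly above the hyperplane. Keeping the parts as parameters treats
    both orientations at once; the larger of the two sets survives the removal.\<close>
  define P where "P = (\<lambda>B C. {i. i < N \<and> (\<forall>c. ((i, c) \<in> B \<longrightarrow> inner a (x (i, c)) < b)
    \<and> ((i, c) \<in> C \<longrightarrow> b < inner a (x (i, c))))})"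
  have fin: "finite (P B C)" for B C by (auto simp: P_def)
  have "{i. i < N \<and> splits a b (x (i, False)) (x (i, True))} \<subseteq> P A1 A2 \<union> P A2 A1"
  proof
    fix i assume i: "i \<in> {i. i < N \<and> splits a b (x (i, False)) (x (i, True))}"
    then have "\<exists>!c. (i, c) \<in> A1" "\<exists>!c. (i, c) \<in> A2" "A1 \<inter> A2 = {}"
      using assms unfolding colorful_partition_def by auto
    then have "(i, True) \<in> A1 \<longleftrightarrow> (i, False) \<notin> A1" "\<forall>c. (i, c) \<in> A2 \<longleftrightarrow> (i, c) \<notin> A1"
      unfolding Ex1_def ex_bool_eq all_bool_eq disjoint_iff by auto
    then show "i \<in> P A1 A2 \<union> P A2 A1"
      using i unfolding P_def splits_def by (cases "(i, True) \<in> A1") (simp_all add: all_bool_eq, blast+)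
  qed
  then have "max_split N x \<le> card (P A1 A2 \<union> P A2 A1)"
    unfolding ab[symmetric] using fin by (intro card_mono) auto
  also have "\<dots> \<le> card (P A1 A2) + card (P A2 A1)" by (rule card_Un_le)
  finally have sum: "max_split N x \<le> card (P A1 A2) + card (P A2 A1)" .
  have compl: "real (card ({..<N} - P B C)) \<le> real N - real (max_split N x) / 2"
    if "max_split N x \<le> 2 * card (P B C)" for B C
  proof -
    have "P B C \<subseteq> {..<N}" by (auto simp: P_def)
    then have "card (P B C) \<le> N" "card ({..<N} - P B C) = N - card (P B C)"
      using fin card_mono[of "{..<N}" "P B C"] by (auto simp: card_Diff_subset)
    then show ?thesis using that by simp
  qed
  have separated: "\<not> tverberg_partition x (remove_pairs ({..<N} - P B C) B)
      (remove_pairs ({..<N} - P B C) C)"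
    if BC: "B \<subseteq> {..<N} \<times> UNIV" "C \<subseteq> {..<N} \<times> UNIV" for B C
  proof (rule not_tverberg_partition_if_separated)
    fix p assume p: "p \<in> remove_pairs ({..<N} - P B C) B"
    obtain i c where ic: "p = (i, c)" by (cases p)
    then have "(i, c) \<in> B" "i \<in> P B C" using p BC(1) by (auto simp: remove_pairs_def)
    then show "inner a (x p) < b" by (simp add: P_def ic)
  next
    fix p assume p: "p \<in> remove_pairs ({..<N} - P B C) C"
    obtain i c where ic: "p = (i, c)" by (cases p)
    then have "(i, c) \<in> C" "i \<in> P B C" using p BC(2) by (auto simp: remove_pairs_def)
    then show "b < inner a (x p)" by (simp add: P_def ic)
  qed
  have A: "A1 \<subseteq> {..<N} \<times> UNIV" "A2 \<subseteq> {..<N} \<times> UNIV"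
    using assms unfolding colorful_partition_def by (metis Un_upper1, metis Un_upper2)
  consider "max_split N x \<le> 2 * card (P A1 A2)" | "max_split N x \<le> 2 * card (P A2 A1)"
    using sum by linarith
  then show ?thesis
  proof cases
    case 1
    show ?thesis
      by (intro exI[of _ "{..<N} - P A1 A2"] conjI compl[OF 1] separated[OF A]) simp
  next
    case 2
    have "\<not> tverberg_partition x (remove_pairs ({..<N} - P A2 A1) A1)
        (remove_pairs ({..<N} - P A2 A1) A2)"
      using separated[OF A(2,1)] unfolding tverberg_partition_def
      by (simp only: Int_commute not_not)
    then show ?thesis
      by (intro exI[of _ "{..<N} - P A2 A1"] conjI compl[OF 2]) simp_all
  qed
qed

section \<open>A good colouring by the union bound\<close>

text \<open>There are at most \<open>N ^ (6 * k)\<close> relevant pairs of traces, and each spoils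
  at most a fraction \<open>1 / N ^ (8 * k)\<close> of the colourings. The point
  \<open>(i, i \<in> E)\<close> goes to the first part; negating \<open>a\<close> and
  \<open>b\<close> covers the opposite orientation.\<close>

lemma ex_balanced_colouring:
  fixes x :: "nat \<times> bool \<Rightarrow> real ^ 'n" and e :: real
  assumes "2 \<le> N" "1 \<le> max_split N x" "0 \<le> e"
    and e: "4 * real (CARD('n) + 1) * (real (max_split N x) * ln (real N)) \<le> e\<^sup>2"
  shows "\<exists>E \<subseteq> {..<N}. \<forall>a b. real (card {i. i < N \<and> inner a (x (i, i \<in> E)) < b
           \<and> b < inner a (x (i, i \<notin> E))}) < real (max_split N x) / 2 + e"
proof -
  define k n where "k = CARD('n) + 1" and "n = max_split N x"
  define X where "X = {..<N} \<times> (UNIV :: bool set)"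
  define H where "H = halfspace_traces x X"
  have X: "finite X" "X \<noteq> {}" "card X = 2 * N"
    using assms(1) by (auto simp: X_def lessThan_empty_iff)
  have n: "n \<ge> 1" using assms by (simp add: n_def)
  \<comment> \<open>A hyperplane is encoded by the traces \<open>L\<close> and \<open>U\<close> of
    its two open sides, since \<open>L\<close> alone does not tell which other points lie on it. Not
    every pair in \<open>H \<times> H\<close> comes from a hyperplane; \<open>K\<close> keeps those
    to which the tail bound with \<open>n\<close> applies.\<close>
  define M where "M = (\<lambda>(L, U). {i. i < N \<and> (\<exists>c. (i, c) \<in> L \<and> (i, \<not> c) \<in> U)})"
  define T where "T = (\<lambda>(L :: (nat \<times> bool) set, U :: (nat \<times> bool) set). {i. (i, True) \<in> L})"
  define K where "K = {p \<in> H \<times> H. card (M p) \<le> n}"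
  define bad where
    "bad p = {E \<in> Pow {..<N}. real (card {i \<in> M p. i \<in> E \<longleftrightarrow> i \<in> T p}) \<ge> real n / 2 + e}" for p
  have finH: "finite H"
    unfolding H_def halfspace_traces_def
    by (rule finite_subset[of _ "Pow X"]) (use X in auto)
  then have finK: "finite K" by (simp add: K_def)
  have "card H \<le> (k + 1) * card X ^ k"
    unfolding H_def using X by (intro card_halfspace_traces_le) (auto simp: k_def)
  \<comment> \<open>All constants are absorbed into powers of \<open>N\<close>: since
    \<open>N \<ge> 2\<close>, also \<open>2 * N \<le> N * N\<close>.\<close>
  also have "\<dots> \<le> 2 ^ k * card X ^ k"
    by (intro mult_right_mono) (auto simp: Suc_le_eq)
  also have "\<dots> \<le> N ^ k * (N * N) ^ k"
    using assms(1) by (intro mult_mono power_mono) (auto simp: X)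
  also have "\<dots> = N ^ (3 * k)"
    by (simp add: power_mult_distrib[symmetric] power_mult power3_eq_cube mult_ac)
  finally have cardH: "card H \<le> N ^ (3 * k)" .
  have "card K \<le> card (H \<times> H)"
    using finH by (intro card_mono) (auto simp: K_def)
  also have "\<dots> \<le> N ^ (3 * k) * N ^ (3 * k)"
    unfolding card_cartesian_product using cardH by (intro mult_mono) auto
  also have "\<dots> = N ^ (6 * k)" by (simp add: power_add[symmetric])
  finally have cardK: "real (card K) \<le> real N ^ (6 * k)"
    by (metis of_nat_le_iff of_nat_power)
  \<comment> \<open>The factor 4 in the hypothesis on \<open>e\<close> produces the exponent
    \<open>8 * k\<close>, which beats the \<open>6 * k\<close> from \<open>cardK\<close>.\<close>
  have "exp (- 2 * e\<^sup>2 / n) \<le> exp (- (real (8 * k) * ln (real N)))"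
    using e n unfolding n_def[symmetric] k_def[symmetric] by (simp add: field_simps)
  also have "\<dots> = 1 / real N ^ (8 * k)"
    using assms(1) by (simp only: exp_minus exp_of_nat_mult) (simp add: divide_inverse)
  finally have exp_le: "exp (- 2 * e\<^sup>2 / n) \<le> 1 / real N ^ (8 * k)" .
  have "real (card (\<Union>p\<in>K. bad p)) \<le> (\<Sum>p\<in>K. real (card (bad p)))"
    using card_UN_le[OF finK, of bad] by (metis of_nat_le_iff of_nat_sum)
  also have "\<dots> \<le> (\<Sum>p\<in>K. 2 ^ N * exp (- 2 * e\<^sup>2 / n))"
  proof (rule sum_mono)
    fix p assume p: "p \<in> K"
    have "M p \<subseteq> {..<N}" by (auto simp: M_def split: prod.splits)
    then show "real (card (bad p)) \<le> 2 ^ N * exp (- 2 * e\<^sup>2 / n)"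
      using card_agreement_ge_le[of "{..<N}" "M p" n e "T p"] p n assms(3)
      by (simp add: bad_def K_def)
  qed
  also have "\<dots> = real (card K) * (2 ^ N * exp (- 2 * e\<^sup>2 / n))" by simp
  also have "\<dots> \<le> real N ^ (6 * k) * (2 ^ N * (1 / real N ^ (8 * k)))"
    using cardK exp_le by (intro mult_mono) auto
  also have "\<dots> = 2 ^ N * (real N ^ (6 * k) / real N ^ (8 * k))" by simp
  also have "\<dots> < 2 ^ N * 1"
  proof (rule mult_strict_left_mono)
    have "real N ^ (6 * k) < real N ^ (8 * k)"
      using assms(1) by (intro power_strict_increasing) (auto simp: k_def)
    then show "real N ^ (6 * k) / real N ^ (8 * k) < 1"
      using assms(1) by (simp add: divide_less_eq_1)
  qed simp
  finally have "card (\<Union>p\<in>K. bad p) < card (Pow {..<N})"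
    by (simp add: card_Pow flip: of_nat_less_iff)
  moreover have "finite (\<Union>p\<in>K. bad p)" using finK by (simp add: bad_def)
  ultimately have "\<not> Pow {..<N} \<subseteq> (\<Union>p\<in>K. bad p)"
    by (meson card_mono not_le)
  then obtain E where E: "E \<subseteq> {..<N}" "\<And>p. p \<in> K \<Longrightarrow> E \<notin> bad p"
    by blast
  have "real (card {i. i < N \<and> inner a (x (i, i \<in> E)) < b \<and> b < inner a (x (i, i \<notin> E))})
      < real n / 2 + e" (is "real (card ?G) < _") for a b
  \<comment> \<open>The bound by \<open>max_split\<close> concerns nonzero normals only. For
    \<open>a = 0\<close> no pair is counted, and the right side is positive as
    \<open>n \<ge> 1\<close>.\<close>
  proof (cases "a = 0")
    case True
    then have "?G = {}" by auto
    then have "card ?G = 0" by (simp only: card.empty)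
    then show ?thesis using n assms(3) by linarith
  next
    case False
    define p where "p = ({q \<in> X. inner a (x q) < b}, {q \<in> X. inner (- a) (x q) < - b})"
    have "M p \<subseteq> {i. i < N \<and> splits a b (x (i, False)) (x (i, True))}"
      unfolding M_def p_def splits_def by (clarsimp simp: ex_bool_eq) blast
    then have "card (M p) \<le> card {i. i < N \<and> splits a b (x (i, False)) (x (i, True))}"
      by (intro card_mono) auto
    also have "\<dots> \<le> n" unfolding n_def by (rule card_split_le_max_split[OF False])
    finally have "card (M p) \<le> n" .
    moreover have "fst p \<in> H" "snd p \<in> H"
      unfolding H_def halfspace_traces_def p_def fst_conv snd_conv by blast+
    ultimately have "p \<in> K" by (simp add: K_def mem_Times_iff)
    then have "real (card {i \<in> M p. i \<in> E \<longleftrightarrow> i \<in> T p}) < real n / 2 + e"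
      using E(1) E(2)[of p] unfolding bad_def by simp
    \<comment> \<open>For a pair in \<open>?G\<close> the point in the lower trace is
      \<open>(i, i \<in> E)\<close> and the other is not, so \<open>i \<in> T p\<close> holds
      exactly when \<open>i \<in> E\<close>.\<close>
    moreover have "card ?G \<le> card {i \<in> M p. i \<in> E \<longleftrightarrow> i \<in> T p}"
    proof (intro card_mono subsetI)
      fix i assume "i \<in> ?G"
      then show "i \<in> {i \<in> M p. i \<in> E \<longleftrightarrow> i \<in> T p}"
        by (cases "i \<in> E") (auto simp: M_def T_def p_def X_def ex_bool_eq)
    qed (auto simp: M_def p_def)
    ultimately show ?thesis by linarith
  qed
  then show ?thesis using E(1) n_def by blast
qed

text \<open>If the hulls were disjoint after \<open>t\<close> removals, a separating hyperplane
  would orient alike all \<open>N - t\<close> remaining pairs. That number equals the strict bound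
  of \<open>ex_balanced_colouring\<close>.\<close>

lemma ex_tolerant_partition:
  fixes x :: "nat \<times> bool \<Rightarrow> real ^ 'n" and e :: real and t :: int
  assumes "2 \<le> N" "1 \<le> max_split N x" "0 \<le> e"
    and "4 * real (CARD('n) + 1) * (real (max_split N x) * ln (real N)) \<le> e\<^sup>2"
    and t: "real_of_int t = real N - real (max_split N x) / 2 - e"
  shows "\<exists>A1 A2. colorful_partition N A1 A2 \<and> tolerant N t x A1 A2"
proof -
  obtain E where E: "E \<subseteq> {..<N}" "\<And>a b. real (card {i. i < N \<and> inner a (x (i, i \<in> E)) < b
           \<and> b < inner a (x (i, i \<notin> E))}) < real (max_split N x) / 2 + e"
    using ex_balanced_colouring[OF assms(1-4)] by blast
  define A1 A2 where "A1 = (\<lambda>i. (i, i \<in> E)) ` {..<N}" and "A2 = (\<lambda>i. (i, i \<notin> E)) ` {..<N}"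
  have "colorful_partition N A1 A2"
    unfolding colorful_partition_def A1_def A2_def by (auto simp: image_iff)
  moreover have "tolerant N t x A1 A2"
    unfolding tolerant_def
  proof (intro allI impI, rule ccontr)
    fix S assume S: "S \<subseteq> {..<N}" "int (card S) = t"
      and neg: "\<not> tverberg_partition x (remove_pairs S A1) (remove_pairs S A2)"
    have "finite (remove_pairs S A1)" "finite (remove_pairs S A2)"
      by (auto simp: remove_pairs_def A1_def A2_def)
    then obtain a b where ab: "\<And>p. p \<in> remove_pairs S A1 \<Longrightarrow> inner a (x p) < b"
      "\<And>p. p \<in> remove_pairs S A2 \<Longrightarrow> b < inner a (x p)"
      using separated_if_not_tverberg_partition[OF _ _ neg] by blast
    let ?G = "{i. i < N \<and> inner a (x (i, i \<in> E)) < b \<and> b < inner a (x (i, i \<notin> E))}"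
    have "{..<N} - S \<subseteq> ?G"
      using ab by (auto simp: remove_pairs_def A1_def A2_def)
    then have "card ({..<N} - S) \<le> card ?G" by (intro card_mono) auto
    moreover have "card ({..<N} - S) = N - card S" "card S \<le> N"
      using S card_mono[of "{..<N}" S] by (auto simp: card_Diff_subset finite_subset)
    moreover have "real (card S) = real_of_int t"
      using S(2) by (metis of_int_of_nat_eq)
    ultimately show False using E(2)[of a b] t by (simp add: of_nat_diff)
  qed
  ultimately show ?thesis by blast
qed

section \<open>Choice of the error term and conclusion\<close>

theorem theorem1p4:
  "(\<exists>C::real. C > 0 \<and>
      (\<forall>(N::nat) (N'::nat) (x :: nat \<times> bool \<Rightarrow> real ^ 'n::finite).
         2 \<le> N \<and> 1 \<le> N' \<and> N' \<le> N \<and> max_split N x = N' \<longrightarrow>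
         (\<exists>A1 A2 (t::int) (e::real).
            colorful_partition N A1 A2 \<and>
            real_of_int t = real N - real N' / 2 - e \<and>
            0 \<le> e \<and> e \<le> C * sqrt (real N' * ln (real N)) \<and>
            tolerant N t x A1 A2)))
   \<and>
   (\<forall>(N::nat) (N'::nat) (x :: nat \<times> bool \<Rightarrow> real ^ 'n::finite) A1 A2.
      1 \<le> N' \<and> N' \<le> N \<and> max_split N x = N' \<and> colorful_partition N A1 A2 \<longrightarrow>
      (\<exists>S \<subseteq> {..<N}.
         real (card S) \<le> real N - real N' / 2 \<and>
         \<not> tverberg_partition x (remove_pairs S A1) (remove_pairs S A2)))"
proof (rule conjI)
  define k where "k = real (CARD('n) + 1)"
  have "4 * sqrt k > 0" by (simp add: k_def)
  moreover have "\<exists>A1 A2 (t::int) (e::real). colorful_partition N A1 A2 \<and>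
      real_of_int t = real N - real N' / 2 - e \<and>
      0 \<le> e \<and> e \<le> 4 * sqrt k * sqrt (real N' * ln (real N)) \<and> tolerant N t x A1 A2"
    if N: "2 \<le> N" "1 \<le> N'" "max_split N x = N'" for N N' and x :: "nat \<times> bool \<Rightarrow> real ^ 'n"
  proof -
    \<comment> \<open>The least value allowed by \<open>ex_tolerant_partition\<close> is
      \<open>s\<close>; rounding \<open>t\<close> down to an integer raises the error to
      \<open>e \<le> s + 1\<close>.\<close>
    define s where "s = sqrt (4 * k * (real N' * ln (real N)))"
    define t where "t = \<lfloor>real N - real N' / 2 - s\<rfloor>"
    define e where "e = real N - real N' / 2 - real_of_int t"
    have "2 / 3 \<le> ln (real N)"
      using N(1) by (intro order_trans[OF ln2_ge_two_thirds] ln_mono) auto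
    moreover have "1 \<le> real N'" "2 \<le> k" using N by (auto simp: k_def Suc_le_eq)
    \<comment> \<open>This gives \<open>s \<ge> 1\<close>, so the rounding loss is absorbed in
      \<open>e \<le> 2 * s\<close>; hence the constant \<open>4 * sqrt k\<close>.\<close>
    ultimately have "4 * 2 * (1 * (2 / 3)) \<le> 4 * k * (real N' * ln (real N))"
      by (intro mult_mono) auto
    then have s: "1 \<le> s" "s\<^sup>2 = 4 * k * (real N' * ln (real N))"
      by (simp_all add: s_def)
    have e: "s \<le> e" "e \<le> s + 1"
      unfolding e_def t_def by linarith+
    have "s\<^sup>2 \<le> e\<^sup>2" using s e by (intro power_mono) auto
    then obtain A1 A2 where "colorful_partition N A1 A2" "tolerant N t x A1 A2"
      using ex_tolerant_partition[of N x e t] N s e unfolding e_def k_def by auto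
    moreover have "e \<le> 4 * sqrt k * sqrt (real N' * ln (real N))"
    proof -
      have "e \<le> 2 * s" using s e by simp
      also have "\<dots> = 4 * sqrt k * sqrt (real N' * ln (real N))"
        by (simp add: s_def real_sqrt_mult)
      finally show ?thesis .
    qed
    moreover have "real_of_int t = real N - real N' / 2 - e" "0 \<le> e"
      using s e by (auto simp: e_def)
    ultimately show ?thesis by blast
  qed
  ultimately show "\<exists>C::real. C > 0 \<and>
      (\<forall>(N::nat) (N'::nat) (x :: nat \<times> bool \<Rightarrow> real ^ 'n::finite).
         2 \<le> N \<and> 1 \<le> N' \<and> N' \<le> N \<and> max_split N x = N' \<longrightarrow>
         (\<exists>A1 A2 (t::int) (e::real).
            colorful_partition N A1 A2 \<and>
            real_of_int t = real N - real N' / 2 - e \<and>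
            0 \<le> e \<and> e \<le> C * sqrt (real N' * ln (real N)) \<and>
            tolerant N t x A1 A2))"
    by blast
qed (use breaking_pairs in blast)

end
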